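(* Let $n\ge1$ and $N\ge1$ be integers, $p_1,\dots,p_n>0$ real with $\sum_i p_i=1$, and let $m$ be any mode of the multinomial distribution with parameters $N$ and $(p_1,\dots,p_n)$. Then $$\lfloor Np_i\rfloor\ \le\ m_i\ <\ Np_i+np_i\qquad(1\le i\le n).$$ In particular $m_i$ is never below $\lfloor Np_i\rfloor$. However, $m_i$ may exceed $\lceil Np_i\rceil$: there exist $n$, $N$, $(p_1,\dots,p_n)$, a mode $m$ and an index $i$ with $m_i>\lceil Np_i\rceil$, so that a mode need not be obtained by rounding each $Np_i$ to a neighbouring integer.
   Context: A mode is a maximiser of $P(m)=\frac{N!}{m_1!\cdots m_n!}\prod_i p_i^{m_i}$ over $m\in\mathbb Z_{\ge0}^n$ with $\sum_i m_i=N$. *)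

theory Defs
  imports Complex_Main
begin

(* Vectors indexed by 1, ..., n are functions on nat of which only the values on {1..n} matter.
   The dimension is not encoded as a type because it is existentially quantified in the theorem. *)

definition positive_prob_vector :: "nat \<Rightarrow> (nat \<Rightarrow> real) \<Rightarrow> bool" where
  "positive_prob_vector n p \<longleftrightarrow> (\<forall>i\<in>{1..n}. p i > 0) \<and> (\<Sum>i = 1..n. p i) = 1"

definition multinomial_prob :: "nat \<Rightarrow> nat \<Rightarrow> (nat \<Rightarrow> real) \<Rightarrow> (nat \<Rightarrow> nat) \<Rightarrow> real" where
  "multinomial_prob n N p m =
     fact N / (\<Prod>i = 1..n. fact (m i)) * (\<Prod>i = 1..n. p i ^ m i)"

definition multinomial_mode :: "nat \<Rightarrow> nat \<Rightarrow> (nat \<Rightarrow> real) \<Rightarrow> (nat \<Rightarrow> nat) \<Rightarrow> bool" where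
  "multinomial_mode n N p m \<longleftrightarrow>
     is_arg_max (multinomial_prob n N p) (\<lambda>m'. (\<Sum>i = 1..n. m' i) = N) m"

end

theory Submission
  imports Defs
begin

text \<open>
  Moving one unit of a mode from coordinate \<open>i\<close> to coordinate \<open>j\<close> cannot increase the
  probability, which gives \<open>m i * p j \<le> (m j + 1) * p i\<close>. Summing over all \<open>j \<noteq> i\<close> yields the
  upper bound \<open>m i \<le> (N + n - 1) * p i\<close>, and summing over all \<open>i \<noteq> j\<close> yields the lower bound
  \<open>m j \<ge> (N + 1) * p j - 1\<close>. A mode that exceeds the ceiling is \<open>(2, 0, 0)\<close> for \<open>N = 2\<close> and
  \<open>p = (1/2, 1/4, 1/4)\<close>.
\<close>

lemma multinomial_prob_eq_prod:
  "multinomial_prob n N p m = fact N * (\<Prod>i = 1..n. p i ^ m i / fact (m i))"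
  by (simp add: multinomial_prob_def prod_dividef)

text \<open>Only the factors at \<open>i\<close> and \<open>j\<close> change, so the two
  probabilities differ by the ratio \<open>m i * p j / (p i * (m j + 1))\<close>; cross-multiplying
  keeps the identity free of division by \<open>p i\<close>.\<close>

lemma multinomial_prob_transfer:
  assumes ij: "i \<in> {1..n}" "j \<in> {1..n}" "i \<noteq> j" and pos: "m i > 0"
  shows "multinomial_prob n N p (m(i := m i - 1, j := m j + 1)) * (p i * (real (m j) + 1))
       = multinomial_prob n N p m * (real (m i) * p j)"
proof -
  let ?A = "{1..n} - {i} - {j}"
  have split: "prod f {1..n} = f i * (f j * prod f ?A)" for f :: "nat \<Rightarrow> real"
    using ij prod.remove[of "{1..n}" i f] prod.remove[of "{1..n} - {i}" j f] by simp
  obtain k where k: "m i = Suc k"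
    using pos gr0_implies_Suc by blast
  have rest: "(\<Prod>l\<in>?A. p l ^ (m(i := k, j := Suc (m j))) l / fact ((m(i := k, j := Suc (m j))) l))
      = (\<Prod>l\<in>?A. p l ^ m l / fact (m l))"
    by (rule prod.cong) auto
  \<comment> \<open>Raising the exponent from \<open>r\<close> to \<open>Suc r\<close> costs a
    factor \<open>x / (r + 1)\<close>. This is used forwards at \<open>j\<close>, which gains a
    unit, and backwards at \<open>i\<close>, which loses one.\<close>
  have step: "x ^ Suc r / fact (Suc r) * (real r + 1) = x * (x ^ r / fact r)" for x :: real and r
  proof -
    have "real r + 1 \<noteq> 0"
      by linarith
    then show ?thesis
      by (simp add: divide_simps)
  qed
  let ?R = "\<Prod>l\<in>?A. p l ^ m l / fact (m l)"
  have "multinomial_prob n N p (m(i := m i - 1, j := m j + 1)) * (p i * (real (m j) + 1))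
      = fact N * ?R * (p i * (p i ^ k / fact k)) * (p j ^ Suc (m j) / fact (Suc (m j)) * (real (m j) + 1))"
    unfolding multinomial_prob_eq_prod split using ij rest
    by (simp add: k del: power_Suc fact_Suc of_nat_Suc)
  also have "\<dots> = fact N * ?R * (p i ^ Suc k / fact (Suc k) * (real k + 1)) * (p j * (p j ^ m j / fact (m j)))"
    by (simp only: step)
  also have "\<dots> = multinomial_prob n N p m * (real (m i) * p j)"
    unfolding multinomial_prob_eq_prod split k by (simp add: add.commute del: power_Suc fact_Suc)
  finally show ?thesis .
qed

lemma multinomial_mode_ratio:
  assumes p: "positive_prob_vector n p" and mode: "multinomial_mode n N p m"
    and ij: "i \<in> {1..n}" "j \<in> {1..n}" "i \<noteq> j"
  shows "real (m i) * p j \<le> (real (m j) + 1) * p i"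
proof (cases "m i = 0")
  \<comment> \<open>There is no unit to move, and \<open>m i - 1\<close> would truncate to 0; the
    left side vanishes.\<close>
  case True
  then show ?thesis
    using p ij by (simp add: positive_prob_vector_def less_imp_le)
next
  case False
  define m' where "m' = m(i := m i - 1, j := m j + 1)"
  have sum_m: "(\<Sum>l = 1..n. m l) = N"
    and max: "\<And>l. (\<Sum>i = 1..n. l i) = N \<Longrightarrow> multinomial_prob n N p l \<le> multinomial_prob n N p m"
    using mode by (auto simp: multinomial_mode_def is_arg_max_def not_less)
  let ?A = "{1..n} - {i} - {j}"
  have split: "sum f {1..n} = f i + (f j + sum f ?A)" for f :: "nat \<Rightarrow> nat"
    using ij sum.remove[of "{1..n}" i f] sum.remove[of "{1..n} - {i}" j f] by simp
  have "sum m' ?A = sum m ?A"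
    by (rule sum.cong) (auto simp: m'_def)
  then have "(\<Sum>l = 1..n. m' l) = N"
    using sum_m ij False unfolding split by (simp add: m'_def)
  then have le: "multinomial_prob n N p m' \<le> multinomial_prob n N p m"
    by (rule max)
  have pos: "\<forall>l\<in>{1..n}. p l > 0"
    using p by (simp add: positive_prob_vector_def)
  \<comment> \<open>Strict positivity allows this common factor to be cancelled at the end.\<close>
  have P: "multinomial_prob n N p m > 0"
    unfolding multinomial_prob_eq_prod using pos by (intro mult_pos_pos prod_pos) auto
  have "multinomial_prob n N p m * (real (m i) * p j)
      = multinomial_prob n N p m' * (p i * (real (m j) + 1))"
    using multinomial_prob_transfer[OF ij] False by (simp add: m'_def)
  also have "\<dots> \<le> multinomial_prob n N p m * (p i * (real (m j) + 1))"
    using le pos ij by (intro mult_right_mono) (auto simp: less_imp_le)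
  finally show ?thesis
    using P by (simp only: mult_le_cancel_left_pos mult.commute[of "p i"])
qed

lemma multinomial_mode_bounds:
  assumes p: "positive_prob_vector n p" and mode: "multinomial_mode n N p m"
    and i: "i \<in> {1..n}"
  shows "real (m i) \<le> (real N + real n - 1) * p i"
    and "(real N + 1) * p i - 1 \<le> real (m i)"
proof -
  let ?A = "{1..n} - {i}"
  have p1: "sum p ?A = 1 - p i"
    using p i by (simp add: positive_prob_vector_def sum_diff1)
  have "(\<Sum>l = 1..n. m l) = N"
    using mode by (simp add: multinomial_mode_def is_arg_max_def)
  then have "(\<Sum>l = 1..n. real (m l)) = real N"
    by (metis of_nat_sum)
  then have m1: "(\<Sum>l\<in>?A. real (m l)) = real N - real (m i)"
    using i by (simp add: sum_diff1)
  have c: "real (card ?A) = real n - 1"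
    using i by (simp add: of_nat_diff)
  have "real (m i) * (1 - p i) = (\<Sum>j\<in>?A. real (m i) * p j)"
    by (simp only: p1 sum_distrib_left[symmetric])
  also have "\<dots> \<le> (\<Sum>j\<in>?A. (real (m j) + 1) * p i)"
    using multinomial_mode_ratio[OF p mode] i by (intro sum_mono) auto
  also have "\<dots> = (real N - real (m i) + (real n - 1)) * p i"
    by (simp only: sum_distrib_right[symmetric] sum.distrib m1 c sum_constant mult_1_right)
  \<comment> \<open>The term \<open>m i * p i\<close> occurs with a minus sign on both sides and
    cancels, as it does again for the lower bound.\<close>
  finally show "real (m i) \<le> (real N + real n - 1) * p i"
    by (simp add: algebra_simps)
  have "(real N - real (m i)) * p i = (\<Sum>j\<in>?A. real (m j) * p i)"
    by (simp only: m1 sum_distrib_right[symmetric])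
  also have "\<dots> \<le> (\<Sum>j\<in>?A. (real (m i) + 1) * p j)"
    using multinomial_mode_ratio[OF p mode] i by (intro sum_mono) auto
  also have "\<dots> = (real (m i) + 1) * (1 - p i)"
    by (simp only: p1 sum_distrib_left[symmetric])
  finally show "(real N + 1) * p i - 1 \<le> real (m i)"
    by (simp add: algebra_simps)
qed

text \<open>The maximum 1/4 is shared by (2,0,0), (1,1,0) and (1,0,1); the other three vectors have
  probability 1/8 or 1/16.\<close>

lemma multinomial_mode_2_0_0:
  "multinomial_mode 3 2 (\<lambda>i. if i = 1 then 1/2 else 1/4) (\<lambda>i. if i = 1 then 2 else 0)"
proof -
  let ?p = "\<lambda>i::nat. if i = 1 then 1/2 else 1/4 :: real"
  have set: "{1..3} = {1, 2, 3::nat}"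
    by auto
  have prob: "multinomial_prob 3 2 ?p m
      = 2 / (fact (m 1) * fact (m 2) * fact (m 3)) * ((1/2) ^ m 1 * (1/4) ^ m 2 * (1/4) ^ m 3)" for m
    unfolding multinomial_prob_def set by (simp add: fact_2 mult.assoc)
  have "multinomial_prob 3 2 ?p m \<le> 1/4" if "(\<Sum>i = 1..3. m i) = 2" for m
  proof -
    have "m 1 + m 2 + m 3 = 2"
      using that unfolding set by simp
    \<comment> \<open>Eliminating \<open>m 3\<close> leaves a finite check over the first two
      coordinates.\<close>
    then have "m 1 \<in> {0, 1, 2}" "m 2 \<in> {0, 1, 2}" and m3: "m 3 = 2 - m 1 - m 2"
      by auto
    then show ?thesis
      unfolding prob m3 by (auto simp: power2_eq_square fact_2)
  qed
  moreover have "multinomial_prob 3 2 ?p (\<lambda>i. if i = 1 then 2 else 0) = 1/4"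
    unfolding prob by (simp add: power2_eq_square fact_2)
  moreover have "(\<Sum>i = 1..3::nat. if i = 1 then 2 else 0) = (2::nat)"
    unfolding set by simp
  ultimately show ?thesis
    unfolding multinomial_mode_def is_arg_max_def by (metis not_less)
qed

theorem proposition3p7:
  shows "(\<forall>(n::nat) (N::nat) (p::nat \<Rightarrow> real) (m::nat \<Rightarrow> nat).
            n \<ge> 1 \<and> N \<ge> 1 \<and> positive_prob_vector n p \<and> multinomial_mode n N p m \<longrightarrow>
            (\<forall>i\<in>{1..n}. \<lfloor>real N * p i\<rfloor> \<le> int (m i) \<and>
                        real (m i) < real N * p i + real n * p i))
       \<and> (\<exists>(n::nat) (N::nat) (p::nat \<Rightarrow> real) (m::nat \<Rightarrow> nat).
            n \<ge> 1 \<and> N \<ge> 1 \<and> positive_prob_vector n p \<and> multinomial_mode n N p m \<and>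
            (\<exists>i\<in>{1..n}. int (m i) > \<lceil>real N * p i\<rceil> \<and>
                        int (m i) \<notin> {\<lfloor>real N * p i\<rfloor>, \<lceil>real N * p i\<rceil>}))"
proof (intro conjI allI impI ballI; (elim conjE)?)
  fix n N p m and i :: nat
  assume p: "positive_prob_vector n p" and mode: "multinomial_mode n N p m" and i: "i \<in> {1..n}"
  have pos: "p i > 0"
    using p i by (simp add: positive_prob_vector_def)
  note bounds = multinomial_mode_bounds[OF p mode i]
  \<comment> \<open>As \<open>p i > 0\<close>, the lower bound gives
    \<open>m i > N * p i - 1\<close>, and an integer above \<open>x - 1\<close> is at least the
    floor of \<open>x\<close>.\<close>
  show "\<lfloor>real N * p i\<rfloor> \<le> int (m i)"
    using bounds(2) pos by (simp add: algebra_simps floor_le_iff)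
  \<comment> \<open>The bound has \<open>n - 1\<close> in place of \<open>n\<close>; the spare
    \<open>p i > 0\<close> makes the inequality strict.\<close>
  show "real (m i) < real N * p i + real n * p i"
    using bounds(1) pos by (simp add: algebra_simps)
next
  let ?p = "\<lambda>i::nat. if i = 1 then 1/2 else 1/4 :: real"
  have "{1..3} = {1, 2, 3::nat}"
    by auto
  then have "positive_prob_vector 3 ?p"
    by (simp add: positive_prob_vector_def del: One_nat_def)
  then show "\<exists>n N p m. n \<ge> 1 \<and> N \<ge> 1 \<and> positive_prob_vector n p \<and> multinomial_mode n N p m \<and>
      (\<exists>i\<in>{1..n}. int (m i) > \<lceil>real N * p i\<rceil> \<and>
         int (m i) \<notin> {\<lfloor>real N * p i\<rfloor>, \<lceil>real N * p i\<rceil>})"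
    using multinomial_mode_2_0_0
    \<comment> \<open>At index 1, \<open>N * p 1 = 1\<close> is its own floor and ceiling, while
      \<open>m 1 = 2\<close>.\<close>
    by (intro exI[of _ 3] exI[of _ 2] exI[of _ ?p] exI[of _ "\<lambda>i. if i = 1 then 2 else 0"]
        conjI bexI[of _ 1]) auto
qed

end
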